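(* Let $\mathcal H$ be a Hilbert space with $\dim\mathcal H=n$, let $\mathcal W=\{W_i\}_{i=1}^m$ be subspaces spanning $\mathcal H$ with $\dim W_i=d_i\ge1$, let $w_i=d_i^{-1/2}$, $\mathcal W_w=(w_i,W_i)_{i=1}^m$, and let $A=A_{\mathcal W_w}$, $B=B_{\mathcal W_w}$. Assume that there exists $v\in\mathbb R^m$ with non-negative entries such that $Bv=\mathbb 1=(1,\dots,1)\in\mathbb R^m$. Let $\operatorname{tr}v=\sum_i v_i$ and $\mathbf a=(\operatorname{tr}v)^{-1/2}(v_1^{1/2},\dots,v_m^{1/2})$. Then $$\|\mathbf a\|=1\quad\text{and}\quad(\operatorname{tr}v)^{-1}=\mathrm{FFP}(\mathbf a\cdot\mathcal W_w)=I_2(A)^2=I(\mathcal W_w).$$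
   Context: $P_W$ is the orthogonal projection onto $W$. $B_{\mathcal W_w}\in\mathcal M_m(\mathbb R)$ is the positive semidefinite matrix with entries $w_i^2w_j^2\operatorname{tr}(P_{W_i}P_{W_j})$, and $A_{\mathcal W_w}\in\mathcal M_m(\mathbb R)$ is the symmetric matrix with entries $A_{ij}=B_{ij}^{1/2}=w_iw_j\operatorname{tr}(P_{W_i}P_{W_j})^{1/2}$. For $\mathbf a\in\mathbb R^m$, $\mathbf a\cdot\mathcal W_w=(a_iw_i,W_i)_{i=1}^m$ and $\mathrm{FFP}(\mathbf a\cdot\mathcal W_w)=\sum_{i,j=1}^m a_i^2a_j^2w_i^2w_j^2\operatorname{tr}(P_{W_i}P_{W_j})$; $I(\mathcal W_w)=\min_{\|\mathbf a\|=1}\mathrm{FFP}(\mathbf a\cdot\mathcal W_w)$ (Euclidean norm on $\mathbb R^m$). For Hermitian $A\in\mathcal M_m(\mathbb C)$, $I_2(A)=\min_{\|x\|=1}\|A\circ xx^*\|_2$, where $\circ$ is the Hadamard (entrywise) product and $\|\cdot\|_2$ is the Frobenius norm. *)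

theory Defs
  imports "HOL-Analysis.Analysis"
begin

text \<open>
  Complex inner product spaces. The inner product is linear in the first argument. Completeness is
  not an axiom: the spaces considered below are finite-dimensional, where it is automatic.
\<close>

class complex_inner_product = ab_group_add +
  fixes scaleC :: "complex \<Rightarrow> 'a \<Rightarrow> 'a"
    and cinner :: "'a \<Rightarrow> 'a \<Rightarrow> complex"
  assumes scaleC_add_right: "scaleC c (x + y) = scaleC c x + scaleC c y"
    and scaleC_add_left: "scaleC (c + d) x = scaleC c x + scaleC d x"
    and scaleC_scaleC: "scaleC c (scaleC d x) = scaleC (c * d) x"
    and scaleC_one: "scaleC 1 x = x"
    and cinner_commute: "cinner x y = cnj (cinner y x)"
    and cinner_add_left: "cinner (x + y) z = cinner x z + cinner y z"
    and cinner_scaleC_left: "cinner (scaleC c x) y = c * cinner x y"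
    and cinner_ge_zero: "0 \<le> Re (cinner x x)"
    and cinner_eq_zero_iff: "cinner x x = 0 \<longleftrightarrow> x = 0"

global_interpretation cvec: vector_space "scaleC :: complex \<Rightarrow> 'a \<Rightarrow> 'a::complex_inner_product"
  by unfold_locales
    (simp_all add: scaleC_add_right scaleC_add_left scaleC_scaleC scaleC_one)

instantiation complex :: complex_inner_product
begin

definition "scaleC (c::complex) (x::complex) = c * x"
definition "cinner (x::complex) (y::complex) = x * cnj y"

instance
  by standard (auto simp: scaleC_complex_def cinner_complex_def algebra_simps)

end

instantiation vec :: (complex_inner_product, finite) complex_inner_product
begin

definition "scaleC c (x::'a^'b) = (\<chi> i. scaleC c (x $ i))"
definition "cinner (x::'a^'b) y = (\<Sum>i\<in>UNIV. cinner (x $ i) (y $ i))"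

instance
proof
  fix x y z :: "'a^'b" and c d :: complex
  show "scaleC c (x + y) = scaleC c x + scaleC c y"
    by (simp add: scaleC_vec_def vec_eq_iff scaleC_add_right)
  show "scaleC (c + d) x = scaleC c x + scaleC d x"
    by (simp add: scaleC_vec_def vec_eq_iff scaleC_add_left)
  show "scaleC c (scaleC d x) = scaleC (c * d) x"
    by (simp add: scaleC_vec_def vec_eq_iff scaleC_scaleC)
  show "scaleC 1 x = x"
    by (simp add: scaleC_vec_def vec_eq_iff scaleC_one)
  show "cinner x y = cnj (cinner y x)"
    unfolding cinner_vec_def cnj_sum by (intro sum.cong refl cinner_commute)
  show "cinner (x + y) z = cinner x z + cinner y z"
    by (simp add: cinner_vec_def cinner_add_left sum.distrib)
  show "cinner (scaleC c x) y = c * cinner x y"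
    by (simp add: cinner_vec_def scaleC_vec_def cinner_scaleC_left sum_distrib_left)
  show "0 \<le> Re (cinner x x)"
    by (simp add: cinner_vec_def sum_nonneg cinner_ge_zero)
  show "cinner x x = 0 \<longleftrightarrow> x = 0"
  proof
    assume "cinner x x = 0"
    then have "(\<Sum>i\<in>UNIV. Re (cinner (x $ i) (x $ i))) = 0"
      unfolding cinner_vec_def by (metis Re_sum zero_complex.sel(1))
    then have re: "Re (cinner (x $ i) (x $ i)) = 0" for i
      by (simp add: sum_nonneg_eq_0_iff cinner_ge_zero)
    have im: "Im (cinner (x $ i) (x $ i)) = 0" for i
      using arg_cong[OF cinner_commute[of "x $ i" "x $ i"], of Im] by simp
    show "x = 0"
      using re im by (simp add: vec_eq_iff complex_eq_iff flip: cinner_eq_zero_iff)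
  next
    assume "x = 0"
    then show "cinner x x = 0"
      by (simp add: cinner_vec_def cinner_eq_zero_iff)
  qed
qed

end

definition orth_proj :: "'a::complex_inner_product set \<Rightarrow> 'a \<Rightarrow> 'a" where
  "orth_proj W x = (THE y. y \<in> W \<and> (\<forall>z\<in>W. cinner (x - y) z = 0))"

definition orthonormal_basis :: "'a::complex_inner_product set \<Rightarrow> bool" where
  "orthonormal_basis E \<longleftrightarrow>
     (\<forall>e\<in>E. \<forall>f\<in>E. cinner e f = (if e = f then 1 else 0)) \<and> cvec.span E = UNIV"

text \<open>
  The trace of a linear operator on a finite-dimensional space; the value does not depend on the
  orthonormal basis chosen.
\<close>

definition op_trace :: "('a::complex_inner_product \<Rightarrow> 'a) \<Rightarrow> complex" where
  "op_trace T = (\<Sum>e\<in>(SOME E. orthonormal_basis E). cinner (T e) e)"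

text \<open>
  A weighted family \<open>(w\<^sub>i, W\<^sub>i)\<close> is given by a weight vector \<open>w\<close> and a family
  of subspaces \<open>W\<close>. The trace of a product of two orthogonal projections is a non-negative
  real, so the real part below discards nothing.
\<close>

definition proj_trace :: "'a::complex_inner_product set \<Rightarrow> 'a set \<Rightarrow> real" where
  "proj_trace V W = Re (op_trace (orth_proj V \<circ> orth_proj W))"

definition B_matrix :: "real^'m \<Rightarrow> ('m \<Rightarrow> 'a::complex_inner_product set) \<Rightarrow> real^'m^'m" where
  "B_matrix w W = (\<chi> i j. (w $ i)\<^sup>2 * (w $ j)\<^sup>2 * proj_trace (W i) (W j))"

definition A_matrix :: "real^'m \<Rightarrow> ('m \<Rightarrow> 'a::complex_inner_product set) \<Rightarrow> real^'m^'m" where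
  "A_matrix w W = (\<chi> i j. w $ i * w $ j * sqrt (proj_trace (W i) (W j)))"

definition FFP :: "real^'m \<Rightarrow> ('m::finite \<Rightarrow> 'a::complex_inner_product set) \<Rightarrow> real" where
  "FFP w W = (\<Sum>i\<in>UNIV. \<Sum>j\<in>UNIV. (w $ i)\<^sup>2 * (w $ j)\<^sup>2 * proj_trace (W i) (W j))"

text \<open>The weights of \<open>a \<cdot> (w\<^sub>i, W\<^sub>i) = (a\<^sub>i w\<^sub>i, W\<^sub>i)\<close>.\<close>

definition reweight :: "real^'m \<Rightarrow> real^'m \<Rightarrow> real^'m" where
  "reweight a w = (\<chi> i. a $ i * w $ i)"

text \<open>
  Minima are rendered by \<open>LEAST\<close>, which is determined only if the minimum is attained.
\<close>

definition min_FFP :: "real^'m \<Rightarrow> ('m::finite \<Rightarrow> 'a::complex_inner_product set) \<Rightarrow> real" where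
  "min_FFP w W = (LEAST r. \<exists>a :: real^'m. norm a = 1 \<and> r = FFP (reweight a w) W)"

definition hadamard :: "complex^'m^'m \<Rightarrow> complex^'m^'m \<Rightarrow> complex^'m^'m" where
  "hadamard M N = (\<chi> i j. M $ i $ j * N $ i $ j)"

definition rank_one :: "complex^'m \<Rightarrow> complex^'m^'m" where
  "rank_one x = (\<chi> i j. x $ i * cnj (x $ j))"

text \<open>The norm of the type \<open>complex^'m^'m\<close> is the Frobenius norm.\<close>

definition I2 :: "complex^'m^'m \<Rightarrow> real" where
  "I2 M = (LEAST r. \<exists>x :: complex^'m. norm x = 1 \<and> r = norm (hadamard M (rank_one x)))"

end

theory Submission
  imports Defs
begin

text \<open>
  With \<open>p\<^sub>i = a\<^sub>i\<^sup>2\<close>, the frame potential of the reweighted family is the quadratic form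
  \<open>p\<^sup>T B p\<close>, and the constraint \<open>\<parallel>a\<parallel> = 1\<close> says that the entries of \<open>p\<close> sum to \<open>1\<close>. Likewise, as
  \<open>A\<^sub>i\<^sub>j\<^sup>2 = B\<^sub>i\<^sub>j\<close>, the squared Frobenius norm of \<open>A \<circ> xx\<^sup>*\<close> is \<open>p\<^sup>T B p\<close> with
  \<open>p\<^sub>i = \<bar>x\<^sub>i\<bar>\<^sup>2\<close>. Both minimisations are therefore the minimisation of \<open>p\<^sup>T B p\<close> over the
  probability simplex.

  Let \<open>t = 1 / tr v\<close> and \<open>q = t v\<close>, so that \<open>B q = t \<one>\<close>. Since \<open>B\<close> is symmetric and positive
  semidefinite, every \<open>p\<close> with entries summing to \<open>1\<close> satisfies
  \<open>0 \<le> (p - q)\<^sup>T B (p - q) = p\<^sup>T B p - t\<close>, with equality at \<open>p = q\<close>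
  (\<open>psd_quadratic_form_lower_bound\<close>). As \<open>v\<close> is non-negative, \<open>q\<close> lies in the simplex and is
  realised by the vector \<open>a\<close> of the theorem, so that the minimum is attained.

  What this needs from the geometry is that \<open>tr (P\<^sub>V P\<^sub>W)\<close> is symmetric and non-negative, and that
  \<open>B\<close> is positive semidefinite. All three follow from
  \<open>tr (P\<^sub>V P\<^sub>W) = \<Sum>\<^sub>e \<langle>P\<^sub>W e, P\<^sub>V e\<rangle> = \<Sum>\<^sub>e \<parallel>P\<^sub>V P\<^sub>W e\<parallel>\<^sup>2\<close>
  over an orthonormal basis, which exists by the Gram-Schmidt process.
\<close>

section \<open>Finite-dimensional complex inner product spaces\<close>

lemma cinner_zero_left [simp]: "cinner 0 (y::'a::complex_inner_product) = 0"
  using cinner_add_left[of 0 0 y] by simp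

lemma cinner_zero_right [simp]: "cinner (x::'a::complex_inner_product) 0 = 0"
  using cinner_commute[of x 0] by simp

lemma cinner_add_right:
  "cinner (x::'a::complex_inner_product) (y + z) = cinner x y + cinner x z"
  by (metis cinner_commute cinner_add_left complex_cnj_add)

lemma cinner_diff_left:
  "cinner (x - y) (z::'a::complex_inner_product) = cinner x z - cinner y z"
  using cinner_add_left[of "x - y" y z] by simp

lemma cinner_scaleC_right:
  "cinner (x::'a::complex_inner_product) (scaleC c y) = cnj c * cinner x y"
  by (metis cinner_commute cinner_scaleC_left complex_cnj_mult)

lemma cinner_sum_left:
  "cinner (\<Sum>i\<in>S. f i) (y::'a::complex_inner_product) = (\<Sum>i\<in>S. cinner (f i) y)"
  by (induction S rule: infinite_finite_induct) (simp_all add: cinner_add_left)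

lemma cinner_sum_right:
  "cinner (x::'a::complex_inner_product) (\<Sum>i\<in>S. f i) = (\<Sum>i\<in>S. cinner x (f i))"
  by (induction S rule: infinite_finite_induct) (simp_all add: cinner_add_right)

lemma cinner_self_eq_of_real:
  "cinner (x::'a::complex_inner_product) x = of_real (Re (cinner x x))"
  using arg_cong[OF cinner_commute[of x x], of Im] by (simp add: complex_eq_iff)

lemma cinner_eq_zero_span:
  fixes x :: "'a::complex_inner_product"
  assumes "\<And>s. s \<in> S \<Longrightarrow> cinner x s = 0" and "z \<in> cvec.span S"
  shows "cinner x z = 0"
  using assms(2)
  by (induction rule: cvec.span_induct_alt)
    (simp_all add: assms(1) cinner_add_right cinner_scaleC_right)

text \<open>Orthonormal sets of vectors, not required to span the space.\<close>

definition orthonormal :: "'a::complex_inner_product set \<Rightarrow> bool" where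
  "orthonormal E \<longleftrightarrow> (\<forall>e\<in>E. \<forall>f\<in>E. cinner e f = (if e = f then 1 else 0))"

lemma orthonormal_basis_iff: "orthonormal_basis E \<longleftrightarrow> orthonormal E \<and> cvec.span E = UNIV"
  by (simp add: orthonormal_basis_def orthonormal_def)

lemma cinner_orthonormal_sum_left:
  assumes "finite E" "orthonormal E" "f \<in> E"
  shows "cinner (\<Sum>e\<in>E. scaleC (c e) e) f = c f"
proof -
  have "cinner (\<Sum>e\<in>E. scaleC (c e) e) f = (\<Sum>e\<in>E. if e = f then c e else 0)"
    unfolding cinner_sum_left using assms
    by (intro sum.cong refl) (auto simp: cinner_scaleC_left orthonormal_def)
  also have "\<dots> = c f"
    using assms by simp
  finally show ?thesis .
qed

text \<open>Subtracting the Fourier expansion of a vector leaves a vector orthogonal to the span.\<close>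

lemma cinner_fourier_remainder:
  assumes "finite E" "orthonormal E" "z \<in> cvec.span E"
  shows "cinner (x - (\<Sum>e\<in>E. scaleC (cinner x e) e)) z = 0"
proof (rule cinner_eq_zero_span[OF _ assms(3)])
  fix f assume "f \<in> E"
  then show "cinner (x - (\<Sum>e\<in>E. scaleC (cinner x e) e)) f = 0"
    using assms by (simp add: cinner_diff_left cinner_orthonormal_sum_left)
qed

lemma fourier_sum_in_span: "(\<Sum>e\<in>E. scaleC (c e) e) \<in> cvec.span E"
  by (intro cvec.span_sum cvec.span_scale cvec.span_base)

lemma fourier_expansion:
  assumes "finite E" "orthonormal E" "x \<in> cvec.span E"
  shows "(\<Sum>e\<in>E. scaleC (cinner x e) e) = x"
proof -
  let ?y = "x - (\<Sum>e\<in>E. scaleC (cinner x e) e)"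
  have "?y \<in> cvec.span E"
    by (intro cvec.span_diff assms(3) fourier_sum_in_span)
  then have "cinner ?y ?y = 0"
    using assms by (intro cinner_fourier_remainder)
  then show ?thesis
    by (simp add: cinner_eq_zero_iff)
qed

lemma parseval:
  assumes "finite E" "orthonormal E" "x \<in> cvec.span E"
  shows "(\<Sum>e\<in>E. cinner x e * cinner e y) = cinner x y"
proof -
  have "cinner x y = cinner (\<Sum>e\<in>E. scaleC (cinner x e) e) y"
    using fourier_expansion[OF assms] by simp
  then show ?thesis
    by (simp add: cinner_sum_left cinner_scaleC_left)
qed

lemma gram_schmidt:
  fixes S :: "'a::complex_inner_product set"
  assumes "finite S"
  shows "\<exists>E. finite E \<and> orthonormal E \<and> cvec.span E = cvec.span S"
  using assms
proof (induction S)
  case empty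
  show ?case
    by (rule exI[of _ "{}"]) (simp add: orthonormal_def)
next
  case (insert s S)
  then obtain E where E: "finite E" "orthonormal E" "cvec.span E = cvec.span S"
    by blast
  define g where "g = (\<Sum>e\<in>E. scaleC (cinner s e) e)"
  define y where "y = s - g"
  have g: "g \<in> cvec.span E"
    unfolding g_def by (rule fourier_sum_in_span)
  have y_orth: "cinner y z = 0" if "z \<in> cvec.span E" for z
    unfolding y_def g_def using E that by (intro cinner_fourier_remainder)
  show ?case
  proof (cases "y = 0")
    case True
    then have "s \<in> cvec.span S"
      using g E(3) by (simp add: y_def)
    then have "cvec.span (insert s S) = cvec.span S"
      by (rule cvec.span_redundant)
    then show ?thesis
      using E by auto
  next
    case False
    define r where "r = Re (cinner y y)"
    have yy: "cinner y y = of_real r"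
      unfolding r_def by (rule cinner_self_eq_of_real)
    have "r \<noteq> 0"
      using False yy cinner_eq_zero_iff[of y] by auto
    then have "r > 0"
      using cinner_ge_zero[of y] by (simp add: r_def)
    define c where "c = complex_of_real (1 / sqrt r)"
    define u where "u = scaleC c y"
    have "c \<noteq> 0"
      using \<open>r > 0\<close> by (simp add: c_def)
    have uu: "cinner u u = 1"
      using \<open>r > 0\<close>
      by (simp add: u_def cinner_scaleC_left cinner_scaleC_right yy c_def flip: of_real_mult)
    have u_orth: "cinner u e = 0" "cinner e u = 0" if "e \<in> E" for e
      using y_orth[OF cvec.span_base[OF that]] cinner_commute[of e u]
      by (simp_all add: u_def cinner_scaleC_left)
    have on: "orthonormal (insert u E)"
      using E(2) uu u_orth by (auto simp: orthonormal_def)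
    have y_eq: "y = scaleC (1 / c) u"
      using \<open>c \<noteq> 0\<close> by (simp add: u_def scaleC_scaleC scaleC_one)
    have "cvec.span (insert u E) = cvec.span (insert s S)"
    proof (rule antisym; rule cvec.span_minimal[OF _ cvec.subspace_span]; rule insert_subsetI)
      have mono: "cvec.span E \<subseteq> cvec.span (insert s S)"
        unfolding E(3) by (intro cvec.span_mono) auto
      then show "E \<subseteq> cvec.span (insert s S)"
        using cvec.span_superset by blast
      have "g \<in> cvec.span (insert s S)"
        using g mono by blast
      then show "u \<in> cvec.span (insert s S)"
        unfolding u_def y_def
        by (intro cvec.span_scale cvec.span_diff) (auto intro: cvec.span_base)
      have mono': "cvec.span E \<subseteq> cvec.span (insert u E)"
        by (intro cvec.span_mono) auto
      then show "S \<subseteq> cvec.span (insert u E)"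
        using cvec.span_superset[of S] E(3) by blast
      have "s = scaleC (1 / c) u + g"
        by (simp add: y_def flip: y_eq)
      moreover have "g \<in> cvec.span (insert u E)"
        using g mono' by blast
      moreover have "u \<in> cvec.span (insert u E)"
        by (simp add: cvec.span_base)
      ultimately show "s \<in> cvec.span (insert u E)"
        by (metis cvec.span_add cvec.span_scale)
    qed
    then show ?thesis
      using E(1) on by (intro exI[of _ "insert u E"]) auto
  qed
qed

lemma subspace_orthonormal_basis:
  fixes W :: "'a::complex_inner_product set"
  assumes fin: "finite S" "cvec.span S = (UNIV :: 'a set)" and W: "cvec.subspace W"
  shows "\<exists>E. finite E \<and> orthonormal E \<and> cvec.span E = W"
proof -
  obtain C where C: "C \<subseteq> W" "cvec.independent C" "W \<subseteq> cvec.span C"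
    by (rule cvec.basis_exists)
  have "finite C"
    using cvec.independent_span_bound[OF fin(1) C(2)] fin(2) by auto
  moreover have "cvec.span C = W"
    using C cvec.span_minimal[OF C(1) W] by blast
  ultimately show ?thesis
    using gram_schmidt by metis
qed

lemma orthonormal_independent:
  assumes "orthonormal E"
  shows "cvec.independent E"
  unfolding cvec.dependent_def
proof clarify
  fix e assume e: "e \<in> E" "e \<in> cvec.span (E - {e})"
  have "cinner e e = 0"
    using assms e by (intro cinner_eq_zero_span[OF _ e(2)]) (auto simp: orthonormal_def)
  then show False
    using assms e by (simp add: orthonormal_def)
qed

section \<open>Orthogonal projections and the trace of their product\<close>

lemma orth_proj_props:
  fixes W :: "'a::complex_inner_product set"
  assumes fin: "finite S" "cvec.span S = (UNIV :: 'a set)" and W: "cvec.subspace W"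
  shows "orth_proj W x \<in> W" and "z \<in> W \<Longrightarrow> cinner (x - orth_proj W x) z = 0"
proof -
  obtain E where E: "finite E" "orthonormal E" "cvec.span E = W"
    using subspace_orthonormal_basis[OF assms] by blast
  have "\<exists>!y. y \<in> W \<and> (\<forall>z\<in>W. cinner (x - y) z = 0)"
  proof (rule ex_ex1I)
    show "\<exists>y. y \<in> W \<and> (\<forall>z\<in>W. cinner (x - y) z = 0)"
      using E(3) fourier_sum_in_span[of "cinner x" E] cinner_fourier_remainder[OF E(1,2), of _ x]
      by blast
  next
    fix y y' assume y: "y \<in> W \<and> (\<forall>z\<in>W. cinner (x - y) z = 0)"
      and y': "y' \<in> W \<and> (\<forall>z\<in>W. cinner (x - y') z = 0)"
    have "y - y' \<in> W"
      using y y' W by (simp add: cvec.subspace_diff)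
    then have "cinner ((x - y') - (x - y)) (y - y') = 0"
      unfolding cinner_diff_left[of "x - y'"] using y y' by simp
    then have "cinner (y - y') (y - y') = 0"
      by simp
    then show "y = y'"
      by (simp add: cinner_eq_zero_iff)
  qed
  from theI'[OF this]
  show "orth_proj W x \<in> W" and "z \<in> W \<Longrightarrow> cinner (x - orth_proj W x) z = 0"
    by (auto simp: orth_proj_def)
qed

lemma orth_proj_self_adjoint:
  fixes W :: "'a::complex_inner_product set"
  assumes "finite S" "cvec.span S = (UNIV :: 'a set)" "cvec.subspace W"
  shows "cinner (orth_proj W x) y = cinner x (orth_proj W y)"
    and "cinner (orth_proj W x) (orth_proj W y) = cinner (orth_proj W x) y"
proof -
  note P = orth_proj_props[OF assms]
  have 1: "cinner x (orth_proj W y) = cinner (orth_proj W x) (orth_proj W y)" for x y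
    using P(2)[OF P(1), of x y] by (simp add: cinner_diff_left)
  then show "cinner (orth_proj W x) (orth_proj W y) = cinner (orth_proj W x) y"
    by (metis cinner_commute)
  with 1 show "cinner (orth_proj W x) y = cinner x (orth_proj W y)"
    by metis
qed

text \<open>
  One orthonormal basis, the one chosen in the definition of the trace, serves all pairs of
  subspaces. The first expansion shows symmetry and positive semidefiniteness, the second
  non-negativity.
\<close>

lemma proj_trace_expansions:
  assumes fin: "\<exists>S. finite S \<and> cvec.span S = (UNIV :: 'a::complex_inner_product set)"
  shows "\<exists>E :: 'a set. finite E \<and> (\<forall>V W. cvec.subspace V \<longrightarrow> cvec.subspace W \<longrightarrow>
    proj_trace V W = (\<Sum>e\<in>E. Re (cinner (orth_proj W e) (orth_proj V e))) \<and>
    proj_trace V W =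
      (\<Sum>e\<in>E. Re (cinner (orth_proj V (orth_proj W e)) (orth_proj V (orth_proj W e)))))"
proof -
  obtain S where S: "finite S" "cvec.span S = (UNIV :: 'a set)"
    using fin by blast
  define E :: "'a set" where "E = (SOME E. orthonormal_basis E)"
  have "\<exists>E :: 'a set. orthonormal_basis E"
    using gram_schmidt[OF S(1)] S(2) by (auto simp: orthonormal_basis_iff)
  then have "orthonormal_basis E"
    unfolding E_def by (rule someI_ex)
  then have E: "orthonormal E" "cvec.span E = UNIV"
    by (auto simp: orthonormal_basis_iff)
  have finE: "finite E"
    using cvec.independent_span_bound[OF S(1) orthonormal_independent[OF E(1)]] S(2) by auto
  have pars: "cinner x y = (\<Sum>e\<in>E. cinner x e * cinner e y)" for x y
    using parseval[OF finE E(1)] E(2) by simp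
  have trA: "op_trace (orth_proj V \<circ> orth_proj W)
          = (\<Sum>e\<in>E. cinner (orth_proj W e) (orth_proj V e))" (is "?T = ?A")
    and trB: "op_trace (orth_proj V \<circ> orth_proj W)
          = (\<Sum>e\<in>E. cinner (orth_proj V (orth_proj W e)) (orth_proj V (orth_proj W e)))"
      (is "_ = ?B")
    if V: "cvec.subspace V" and W: "cvec.subspace W" for V W
  proof -
    note saV = orth_proj_self_adjoint[OF S V] and saW = orth_proj_self_adjoint[OF S W]
    show tr: "?T = ?A"
      by (simp add: op_trace_def saV flip: E_def)
    \<comment> \<open>The double expansion below is the cyclicity of the trace, applied to
      \<open>P\<^sub>V P\<^sub>W P\<^sub>W\<close>.\<close>
    have "?A = (\<Sum>e\<in>E. cinner (orth_proj W e) (orth_proj W (orth_proj V e)))"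
      by (simp add: saW(2))
    also have "\<dots> = (\<Sum>e\<in>E. \<Sum>f\<in>E. cinner (orth_proj W e) f * cinner f (orth_proj W (orth_proj V e)))"
      by (subst pars) (rule refl)
    also have "\<dots> = (\<Sum>f\<in>E. \<Sum>e\<in>E. cinner (orth_proj V (orth_proj W f)) e * cinner e (orth_proj W f))"
      by (subst sum.swap) (simp add: saW(1) saV(1) mult.commute)
    also have "\<dots> = (\<Sum>f\<in>E. cinner (orth_proj V (orth_proj W f)) (orth_proj W f))"
      by (subst (2) pars) (rule refl)
    also have "\<dots> = ?B"
      by (simp add: saV(2))
    finally show "?T = ?B"
      using tr by simp
  qed
  show ?thesis
  proof (intro exI[of _ E] conjI allI impI finE)
    fix V W :: "'a set" assume VW: "cvec.subspace V" "cvec.subspace W"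
    show "proj_trace V W = (\<Sum>e\<in>E. Re (cinner (orth_proj W e) (orth_proj V e)))"
      by (simp only: proj_trace_def trA[OF VW] Re_sum)
    show "proj_trace V W =
        (\<Sum>e\<in>E. Re (cinner (orth_proj V (orth_proj W e)) (orth_proj V (orth_proj W e))))"
      by (simp only: proj_trace_def trB[OF VW] Re_sum)
  qed
qed

lemma proj_trace_nonneg:
  fixes V W :: "'a::complex_inner_product set"
  assumes "\<exists>S :: 'a set. finite S \<and> cvec.span S = UNIV" "cvec.subspace V" "cvec.subspace W"
  shows "proj_trace V W \<ge> 0"
proof -
  obtain E :: "'a set" where
    "proj_trace V W =
      (\<Sum>e\<in>E. Re (cinner (orth_proj V (orth_proj W e)) (orth_proj V (orth_proj W e))))"
    using proj_trace_expansions[OF assms(1)] assms(2,3) by meson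
  then show ?thesis
    by (simp add: sum_nonneg cinner_ge_zero)
qed

lemma proj_trace_commute:
  fixes V W :: "'a::complex_inner_product set"
  assumes "\<exists>S :: 'a set. finite S \<and> cvec.span S = UNIV" "cvec.subspace V" "cvec.subspace W"
  shows "proj_trace V W = proj_trace W V"
proof -
  have "Re (cinner x y) = Re (cinner y x)" for x y :: 'a
    by (metis cinner_commute cnj.sel(1))
  then show ?thesis
    using proj_trace_expansions[OF assms(1)] assms(2,3) by (metis (no_types, lifting) sum.cong)
qed

text \<open>
  For each basis vector \<open>e\<close> the matrix of \<open>Re \<langle>P\<^sub>j e, P\<^sub>i e\<rangle>\<close> is a Gram matrix, and the matrix of
  traces is the sum of these.
\<close>

lemma proj_trace_psd:
  fixes W :: "'m::finite \<Rightarrow> 'a::complex_inner_product set"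
  assumes "\<exists>S :: 'a set. finite S \<and> cvec.span S = UNIV" "\<And>i. cvec.subspace (W i)"
  shows "0 \<le> (\<Sum>i\<in>UNIV. \<Sum>j\<in>UNIV. c i * c j * proj_trace (W i) (W j))"
proof -
  obtain E :: "'a set" where E:
    "\<And>i j. proj_trace (W i) (W j) = (\<Sum>e\<in>E. Re (cinner (orth_proj (W j) e) (orth_proj (W i) e)))"
    using proj_trace_expansions[OF assms(1)] assms(2) by meson
  define g where "g e = (\<Sum>i\<in>UNIV. scaleC (of_real (c i)) (orth_proj (W i) e))" for e
  have "(\<Sum>i\<in>UNIV. \<Sum>j\<in>UNIV. c i * c j * proj_trace (W i) (W j))
      = (\<Sum>i\<in>UNIV. \<Sum>j\<in>UNIV. \<Sum>e\<in>E. c i * c j * Re (cinner (orth_proj (W j) e) (orth_proj (W i) e)))"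
    by (simp add: E sum_distrib_left)
  also have "\<dots> = (\<Sum>i\<in>UNIV. \<Sum>e\<in>E. \<Sum>j\<in>UNIV. c i * c j * Re (cinner (orth_proj (W j) e) (orth_proj (W i) e)))"
    by (intro sum.cong refl) (rule sum.swap)
  also have "\<dots> = (\<Sum>e\<in>E. \<Sum>i\<in>UNIV. \<Sum>j\<in>UNIV. c i * c j * Re (cinner (orth_proj (W j) e) (orth_proj (W i) e)))"
    by (rule sum.swap)
  also have "\<dots> = (\<Sum>e\<in>E. Re (cinner (g e) (g e)))"
    by (simp add: g_def cinner_sum_left cinner_sum_right cinner_scaleC_left cinner_scaleC_right
        sum_distrib_left mult_ac)
  also have "\<dots> \<ge> 0"
    by (intro sum_nonneg cinner_ge_zero)
  finally show ?thesis .
qed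

section \<open>Quadratic forms on the probability simplex\<close>

lemma inner_matrix_vector_eq_sum:
  fixes B :: "real^'m^'m" and x y :: "real^'m"
  shows "x \<bullet> (B *v y) = (\<Sum>i\<in>UNIV. \<Sum>j\<in>UNIV. x $ i * y $ j * B $ i $ j)"
  by (simp add: inner_vec_def matrix_vector_mult_def sum_distrib_left mult_ac)

text \<open>
  The bound holds on the whole hyperplane of vectors with entry sum \<open>1\<close>, not only on the simplex;
  it is obtained by evaluating the form at \<open>p - t v\<close> with \<open>t = 1 / tr v\<close>.
\<close>

lemma psd_quadratic_form_lower_bound:
  fixes B :: "real^'m^'m" and v p :: "real^'m"
  assumes sym: "transpose B = B" and psd: "\<And>x. 0 \<le> x \<bullet> (B *v x)"
    and v: "B *v v = (\<chi> i. 1)" "(\<Sum>i\<in>UNIV. v $ i) > 0" and p: "(\<Sum>i\<in>UNIV. p $ i) = 1"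
  shows "inverse (\<Sum>i\<in>UNIV. v $ i) \<le> p \<bullet> (B *v p)"
proof -
  define s where "s = (\<Sum>i\<in>UNIV. v $ i)"
  define t where "t = inverse s"
  have ts: "t * s = 1"
    using v(2) by (simp add: t_def s_def)
  have pv: "p \<bullet> (B *v v) = 1" and vv: "v \<bullet> (B *v v) = s"
    using p by (simp_all add: v(1) inner_vec_def s_def)
  have "v \<bullet> (B *v p) = p \<bullet> (B *v v)"
    by (metis dot_lmul_matrix inner_commute sym vector_transpose_matrix)
  with pv have vp: "v \<bullet> (B *v p) = 1"
    by simp
  have "0 \<le> (p - t *\<^sub>R v) \<bullet> (B *v (p - t *\<^sub>R v))"
    by (rule psd)
  also have "\<dots> = p \<bullet> (B *v p) - t * (p \<bullet> (B *v v)) - t * (v \<bullet> (B *v p)) + t * (t * (v \<bullet> (B *v v)))"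
    by (simp add: matrix_vector_mult_scaleR algebra_simps)
  also have "\<dots> = p \<bullet> (B *v p) - t"
    by (simp add: pv vp vv ts)
  finally show ?thesis
    by (simp add: t_def s_def)
qed

lemma norm_vec_sq: "(norm (x::'b::real_normed_vector^'m))\<^sup>2 = (\<Sum>i\<in>UNIV. (norm (x $ i))\<^sup>2)"
  by (simp add: norm_vec_def L2_set_def sum_nonneg)

lemma FFP_reweight:
  "FFP (reweight b w) W = (\<chi> i. (b $ i)\<^sup>2) \<bullet> (B_matrix w W *v (\<chi> i. (b $ i)\<^sup>2))"
  unfolding inner_matrix_vector_eq_sum
  by (simp add: FFP_def reweight_def B_matrix_def power_mult_distrib mult_ac)

lemma norm_hadamard_A_matrix_sq:
  fixes W :: "'m::finite \<Rightarrow> 'a::complex_inner_product set" and x :: "complex^'m"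
  assumes "\<And>i j. proj_trace (W i) (W j) \<ge> 0"
  shows "(norm (hadamard (map_matrix complex_of_real (A_matrix w W)) (rank_one x)))\<^sup>2
    = (\<chi> i. (norm (x $ i))\<^sup>2) \<bullet> (B_matrix w W *v (\<chi> i. (norm (x $ i))\<^sup>2))"
  unfolding inner_matrix_vector_eq_sum norm_vec_sq
  using assms
  by (simp add: hadamard_def rank_one_def A_matrix_def B_matrix_def map_matrix_def norm_mult
      power_mult_distrib mult_ac)

section \<open>The optimal weights\<close>

theorem corollary5p2p5:
  fixes W :: "'m::finite \<Rightarrow> 'a::complex_inner_product set"
    and n :: nat
    and d :: "'m \<Rightarrow> nat"
    and w v a :: "real^'m"
    and A B :: "real^'m^'m"
  assumes finite_dim: "\<exists>E :: 'a set. finite E \<and> cvec.span E = UNIV"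
    and dim_n: "cvec.dim (UNIV :: 'a set) = n"
    and subspaces: "\<And>i. cvec.subspace (W i)"
    and spanning: "cvec.span (\<Union>i. W i) = UNIV"
    and dims: "\<And>i. cvec.dim (W i) = d i"
    and dims_ge_1: "\<And>i. d i \<ge> 1"
    and w_eq: "w = (\<chi> i. real (d i) powr (- 1 / 2))"
    and A_eq: "A = A_matrix w W"
    and B_eq: "B = B_matrix w W"
    and v_nonneg: "\<And>i. v $ i \<ge> 0"
    and v_solves: "B *v v = (\<chi> i. 1)"
    and a_eq: "a = (\<chi> i. (\<Sum>k\<in>UNIV. v $ k) powr (- 1 / 2) * sqrt (v $ i))"
  shows "norm a = 1
    \<and> inverse (\<Sum>i\<in>UNIV. v $ i) = FFP (reweight a w) W
    \<and> FFP (reweight a w) W = (I2 (map_matrix complex_of_real A))\<^sup>2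
    \<and> (I2 (map_matrix complex_of_real A))\<^sup>2 = min_FFP w W"
proof -
  define s where "s = (\<Sum>i\<in>UNIV. v $ i)"
  define q :: "real^'m" where "q = (\<chi> i. (a $ i)\<^sup>2)"
  have pt_nonneg: "proj_trace (W i) (W j) \<ge> 0" for i j
    using finite_dim subspaces by (intro proj_trace_nonneg)
  have "v \<noteq> 0"
  proof
    assume "v = 0"
    then have "(\<chi> i. 1) = (0 :: real^'m)"
      using v_solves by simp
    then show False
      by (simp add: vec_eq_iff)
  qed
  then obtain k where "v $ k \<noteq> 0"
    by (auto simp: vec_eq_iff)
  then have s_pos: "s > 0"
    unfolding s_def using v_nonneg by (intro sum_pos2[of _ k]) (auto simp: less_le)
  have q_eq: "q = inverse s *\<^sub>R v"
    using v_nonneg s_pos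
    by (simp add: q_def a_eq vec_eq_iff power_mult_distrib powr_minus powr_half_sqrt
        power_inverse flip: s_def)
  have "(norm a)\<^sup>2 = (\<Sum>i\<in>UNIV. q $ i)"
    by (simp add: norm_vec_sq q_def)
  also have "\<dots> = 1"
    using s_pos by (simp add: q_eq s_def flip: sum_distrib_left)
  finally have norm_a: "norm a = 1"
    by (simp add: power2_eq_iff_nonneg[of _ 1, simplified])
  have qBq: "q \<bullet> (B *v q) = inverse s"
  proof -
    have "v \<bullet> (B *v v) = s"
      by (simp add: v_solves inner_vec_def s_def)
    then show ?thesis
      using s_pos by (simp add: q_eq matrix_vector_mult_scaleR)
  qed
  have sym: "transpose B = B"
    using finite_dim subspaces
    by (simp add: B_eq B_matrix_def transpose_def vec_eq_iff mult_ac proj_trace_commute)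
  have psd: "0 \<le> x \<bullet> (B *v x)" for x
    using proj_trace_psd[where W = W and c = "\<lambda>i. x $ i * (w $ i)\<^sup>2", OF finite_dim subspaces]
    by (simp add: inner_matrix_vector_eq_sum B_eq B_matrix_def mult_ac)
  \<comment> \<open>The entries of \<open>x\<close> are real in the bound on the frame potential, complex in that on \<open>I2\<close>.\<close>
  have bound: "inverse s \<le> (\<chi> i. (norm (x $ i))\<^sup>2) \<bullet> (B *v (\<chi> i. (norm (x $ i))\<^sup>2))"
    if "norm x = 1" for x :: "'b::real_normed_vector^'m"
    unfolding s_def using that s_pos
    by (intro psd_quadratic_form_lower_bound sym psd v_solves)
      (simp_all add: s_def flip: norm_vec_sq)
  have FFP_a: "FFP (reweight a w) W = inverse s"
    using qBq by (simp add: FFP_reweight q_def B_eq)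
  have min: "min_FFP w W = inverse s"
    unfolding min_FFP_def
  proof (rule Least_equality)
    show "\<exists>b. norm b = 1 \<and> inverse s = FFP (reweight b w) W"
      using norm_a FFP_a by auto
  next
    fix r assume "\<exists>b. norm b = 1 \<and> r = FFP (reweight b w) W"
    then obtain b where "norm b = 1" "r = FFP (reweight b w) W"
      by blast
    then show "inverse s \<le> r"
      using bound[of b] by (simp add: FFP_reweight B_eq)
  qed
  have "I2 (map_matrix complex_of_real A) = sqrt (inverse s)"
    unfolding I2_def
  proof (rule Least_equality)
    define x :: "complex^'m" where "x = (\<chi> i. of_real (a $ i))"
    have "norm x = norm a"
      by (simp add: x_def norm_vec_def)
    moreover have "(norm (hadamard (map_matrix complex_of_real A) (rank_one x)))\<^sup>2 = inverse s"
      using qBq pt_nonneg by (simp add: A_eq norm_hadamard_A_matrix_sq x_def q_def B_eq)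
    then have "sqrt (inverse s) = norm (hadamard (map_matrix complex_of_real A) (rank_one x))"
      by (intro real_sqrt_unique) auto
    ultimately show "\<exists>x. norm x = 1
        \<and> sqrt (inverse s) = norm (hadamard (map_matrix complex_of_real A) (rank_one x))"
      using norm_a by auto
  next
    fix r assume "\<exists>x. norm x = 1 \<and> r = norm (hadamard (map_matrix complex_of_real A) (rank_one x))"
    then obtain x where x: "norm x = 1"
      and r: "r = norm (hadamard (map_matrix complex_of_real A) (rank_one x))"
      by blast
    have "inverse s \<le> r\<^sup>2"
      using bound[OF x] pt_nonneg by (simp add: r A_eq norm_hadamard_A_matrix_sq B_eq)
    then show "sqrt (inverse s) \<le> r"
      by (intro real_le_lsqrt) (auto simp: r)
  qed
  then have I2: "(I2 (map_matrix complex_of_real A))\<^sup>2 = inverse s"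
    using s_pos by simp
  show ?thesis
    using norm_a FFP_a min I2 by (simp add: s_def)
qed

end
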